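(* Let $f:[0,1]\to\mathbb{R}$ be differentiable on $[0,1]$. Then for all $0\le a<b\le 1$, $$\left(\frac{\partial}{\partial a}+\frac{\partial}{\partial b}\right)\mathrm{DQ}_f(a,b)=\mathrm{DQ}_{f'}(a,b).$$
   Context: For a function $g:[0,1]\to\mathbb{R}$, the difference quotient of $g$ is $\mathrm{DQ}_g(a,b)=\dfrac{g(b)-g(a)}{b-a}$, defined on $\mathcal{T}=\{(a,b)\in\mathbb{R}^2: 0\le a<b\le 1\}$. Derivatives at the endpoints $0$ and $1$ of $[0,1]$, and the partial derivatives in $a$ at $a=0$ and in $b$ at $b=1$, are one-sided. *)

theory Defs imports "HOL-Analysis.Analysis" begin

definition DQ :: "(real \<Rightarrow> real) \<Rightarrow> real \<Rightarrow> real \<Rightarrow> real" where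
  "DQ g a b = (g b - g a) / (b - a)"

definition DQ_domain :: "(real \<times> real) set" where
  "DQ_domain = {(a, b). 0 \<le> a \<and> a < b \<and> b \<le> 1}"

text \<open>
  Functions on the unit interval are represented by total functions on the reals, whose values
  outside the interval are irrelevant. All derivatives are therefore taken within the domain
  of definition: this makes them one-sided at its boundary points and ordinary derivatives at
  interior points. For real-valued functions, \<^const>\<open>vector_derivative\<close> is the usual derivative.
\<close>

definition deriv_unit :: "(real \<Rightarrow> real) \<Rightarrow> real \<Rightarrow> real" where
  "deriv_unit f x = vector_derivative f (at x within {0..1})"

definition partial_a_exists :: "(real \<Rightarrow> real \<Rightarrow> real) \<Rightarrow> real \<Rightarrow> real \<Rightarrow> bool" where
  "partial_a_exists G a b \<longleftrightarrow> (\<lambda>s. G s b) differentiable (at a within {s. (s, b) \<in> DQ_domain})"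

definition partial_b_exists :: "(real \<Rightarrow> real \<Rightarrow> real) \<Rightarrow> real \<Rightarrow> real \<Rightarrow> bool" where
  "partial_b_exists G a b \<longleftrightarrow> (\<lambda>t. G a t) differentiable (at b within {t. (a, t) \<in> DQ_domain})"

definition partial_a :: "(real \<Rightarrow> real \<Rightarrow> real) \<Rightarrow> real \<Rightarrow> real \<Rightarrow> real" where
  "partial_a G a b = vector_derivative (\<lambda>s. G s b) (at a within {s. (s, b) \<in> DQ_domain})"

definition partial_b :: "(real \<Rightarrow> real \<Rightarrow> real) \<Rightarrow> real \<Rightarrow> real \<Rightarrow> real" where
  "partial_b G a b = vector_derivative (\<lambda>t. G a t) (at b within {t. (a, t) \<in> DQ_domain})"

end

theory Submission imports Defs begin

text \<open>
  Write \<open>D = DQ f a b\<close>. The quotient rule gives the partial derivatives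
  \<open>(D - f' a) / (b - a)\<close> in \<open>a\<close> and \<open>(f' b - D) / (b - a)\<close> in \<open>b\<close>: when an
  endpoint moves, the secant slope changes in proportion to its gap to the tangent slope there.
  In the sum the two copies of \<open>D\<close> cancel, and what is left is the difference quotient
  of \<open>f'\<close>.

  The derivatives are taken within sets, namely \<open>{0..1}\<close> for \<open>f\<close> and the slices \<open>{0..<b}\<close> and
  \<open>{a<..1}\<close> of the triangle for the difference quotient. The slices are subsets of \<open>{0..1}\<close>, so
  the derivatives of \<open>f\<close> restrict to them. Each of these sets accumulates at the points where a
  derivative within it is taken (both slices contain \<open>{a<..<b}\<close>, which accumulates at \<open>a\<close> and at
  \<open>b\<close>); hence the derivatives within them are unique and are the values that \<^const>\<open>vector_derivative\<close> selects.
\<close>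

lemma DQ_domain_slice_a:
  assumes "b \<le> 1"
  shows "{s. (s, b) \<in> DQ_domain} = {0..<b}"
  using assms by (auto simp: DQ_domain_def)

lemma DQ_domain_slice_b:
  assumes "0 \<le> a"
  shows "{t. (a, t) \<in> DQ_domain} = {a<..1}"
  using assms by (auto simp: DQ_domain_def)

lemma vector_derivative_within_eqI:
  fixes g :: "real \<Rightarrow> real"
  assumes "(g has_real_derivative D) (at x within S)" and "x islimpt S"
  shows "vector_derivative g (at x within S) = D"
  using assms
  by (simp add: vector_derivative_within has_real_derivative_iff_has_vector_derivative
      trivial_limit_within)

lemma has_real_derivative_deriv_unit:
  assumes "f differentiable_on {0..1}" and "x \<in> {0..1}"
  shows "(f has_real_derivative deriv_unit f x) (at x within {0..1})"
proof -
  obtain D where D: "(f has_real_derivative D) (at x within {0..1})"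
    using assms unfolding differentiable_on_def real_differentiable_def by blast
  moreover have "x islimpt {0..1}"
    using assms(2) by simp
  ultimately show ?thesis
    unfolding deriv_unit_def by (metis vector_derivative_within_eqI)
qed

lemma DQ_has_real_derivative_left_endpoint:
  assumes "(f has_real_derivative d) (at a within S)" and "a \<noteq> b"
  shows "((\<lambda>s. DQ f s b) has_real_derivative (DQ f a b - d) / (b - a)) (at a within S)"
  unfolding DQ_def using assms
  by (auto intro!: derivative_eq_intros simp: field_simps)

lemma DQ_has_real_derivative_right_endpoint:
  assumes "(f has_real_derivative d) (at b within S)" and "a \<noteq> b"
  shows "((\<lambda>t. DQ f a t) has_real_derivative (d - DQ f a b) / (b - a)) (at b within S)"
  unfolding DQ_def using assms
  by (auto intro!: derivative_eq_intros simp: field_simps)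

theorem theorem6:
  fixes f :: "real \<Rightarrow> real" and a b :: real
  assumes "f differentiable_on {0..1}"
    and "0 \<le> a" and "a < b" and "b \<le> 1"
  shows "partial_a_exists (DQ f) a b \<and> partial_b_exists (DQ f) a b \<and>
    partial_a (DQ f) a b + partial_b (DQ f) a b = DQ (deriv_unit f) a b"
proof -
  let ?D = "DQ f a b" and ?f' = "deriv_unit f"
  have "(f has_real_derivative ?f' a) (at a within {0..<b})"
    by (rule DERIV_subset[OF has_real_derivative_deriv_unit[OF assms(1)]]) (use assms in auto)
  then have left: "((\<lambda>s. DQ f s b) has_real_derivative (?D - ?f' a) / (b - a)) (at a within {0..<b})"
    using assms by (intro DQ_has_real_derivative_left_endpoint) auto
  have "(f has_real_derivative ?f' b) (at b within {a<..1})"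
    by (rule DERIV_subset[OF has_real_derivative_deriv_unit[OF assms(1)]]) (use assms in auto)
  then have right: "((\<lambda>t. DQ f a t) has_real_derivative (?f' b - ?D) / (b - a)) (at b within {a<..1})"
    using assms by (intro DQ_has_real_derivative_right_endpoint) auto
  have "a islimpt {0..<b}"
    using islimpt_greaterThanLessThan1[OF assms(3)] by (rule islimpt_subset) (use assms in auto)
  then have pa: "partial_a (DQ f) a b = (?D - ?f' a) / (b - a)"
    using left assms by (simp add: partial_a_def DQ_domain_slice_a vector_derivative_within_eqI)
  have "b islimpt {a<..1}"
    using islimpt_greaterThanLessThan2[OF assms(3)] by (rule islimpt_subset) (use assms in auto)
  then have pb: "partial_b (DQ f) a b = (?f' b - ?D) / (b - a)"
    using right assms by (simp add: partial_b_def DQ_domain_slice_b vector_derivative_within_eqI)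
  have "partial_a_exists (DQ f) a b" "partial_b_exists (DQ f) a b"
    using left right assms
    by (auto simp: partial_a_exists_def partial_b_exists_def DQ_domain_slice_a DQ_domain_slice_b
        real_differentiable_def)
  moreover have "partial_a (DQ f) a b + partial_b (DQ f) a b = DQ ?f' a b"
    unfolding pa pb DQ_def[of ?f'] by (simp flip: add_divide_distrib)
  ultimately show ?thesis by blast
qed

end
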